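(* Let $\mu$ and $\mu'$ be shift-invariant Borel probability measures on $\Omega_\pm$, and let $\lambda$ and $\lambda'$ be the measures obtained from the ergodic decomposition applied to $\mu$ and $\mu'$, respectively. If the $\mu\times\mu'\times\mu_N$-measure of the set of all $(\omega,\omega',\mathbf v)\in X$ without stable periodic orbits is zero, then for $\lambda$-a.e. (and for $\lambda'$-a.e.) $\nu\in\mathcal E$ we have $\int_{\Omega_\pm}\omega_0\,d\nu(\omega)=0$.
   Context: $\Omega_\pm=\{\pm1\}^{\mathbb Z}$ with the product topology, $\sigma(\omega)_n=\omega_{n+1}$, $N=\{(1,0),(0,1),(-1,0),(0,-1)\}$, $\mu_N$ the uniform probability measure on $N$, $X=\Omega_\pm\times\Omega_\pm\times N$, and $$\Phi(\omega,\omega',(a,b))=(\sigma^{sb}(\omega),\sigma^{sa}(\omega'),s(b,a)),\qquad s=\omega_0\omega'_0 .$$ A point $(\omega,\omega',\mathbf v)\in X$ has a stable periodic orbit if for some $n\ge1$ there are open neighborhoods $U$ of $\omega$ and $U'$ of $\omega'$ such that $\Phi^n(\eta,\eta',\mathbf v)=(\eta,\eta',\mathbf v)$ for all $(\eta,\eta')\in U\times U'$. Ergodic decomposition: let $\mathcal E$ denote the set of ergodic shift-invariant Borel probability measures on $\Omega_\pm$, inside the space of all shift-invariant Borel probability measures. For a shift-invariant probability measure $\mu$ there is a unique probability measure $\lambda$ on the space of shift-invariant probability measures with $\lambda(\mathcal E)=1$ and $\int_{\Omega_\pm}f\,d\mu=\int_{\mathcal E}\int_{\Omega_\pm}f\,d\nu\,d\lambda(\nu)$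 for all continuous $f:\Omega_\pm\to\mathbb R$. *)

theory Defs
  imports "HOL-Probability.Probability"
begin

instance int :: second_countable_topology
proof
  have "open = generate_topology (range (\<lambda>n::int. {n}))"
  proof (intro ext iffI)
    fix S :: "int set"
    have "generate_topology (range (\<lambda>n::int. {n})) (\<Union>n\<in>S. {n})"
      by (intro generate_topology_Union generate_topology.Basis) auto
    then show "generate_topology (range (\<lambda>n::int. {n})) S"
      by simp
  qed (rule Topological_Spaces.open_discrete)
  then show "\<exists>B::int set set. countable B \<and> open = generate_topology B"
    by (intro exI[of _ "range (\<lambda>n::int. {n})"]) auto
qed

text \<open>Since \<open>int\<close> is discrete, the subspace topology inherited from \<open>int \<Rightarrow> int\<close> is the
  product topology of the two-point discrete space.\<close>

definition Omega :: "(int \<Rightarrow> int) set" where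
  "Omega = {\<omega>. \<forall>n. \<omega> n = 1 \<or> \<omega> n = -1}"

definition Omega_borel :: "(int \<Rightarrow> int) measure" where
  "Omega_borel = restrict_space borel Omega"

definition shift :: "(int \<Rightarrow> int) \<Rightarrow> int \<Rightarrow> int" where
  "shift \<omega> = (\<lambda>n. \<omega> (n + 1))"

definition shift_pow :: "int \<Rightarrow> (int \<Rightarrow> int) \<Rightarrow> int \<Rightarrow> int" where
  "shift_pow k = (if 0 \<le> k then shift ^^ nat k else inv shift ^^ nat (- k))"

definition N_dirs :: "(int \<times> int) set" where
  "N_dirs = {(1, 0), (0, 1), (-1, 0), (0, -1)}"

definition mu_N :: "(int \<times> int) measure" where
  "mu_N = uniform_count_measure N_dirs"

type_synonym state = "(int \<Rightarrow> int) \<times> (int \<Rightarrow> int) \<times> (int \<times> int)"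

definition X_space :: "state set" where
  "X_space = Omega \<times> Omega \<times> N_dirs"

definition Phi :: "state \<Rightarrow> state" where
  "Phi = (\<lambda>(\<omega>, \<omega>', (a, b)).
     let s = \<omega> 0 * \<omega>' 0
     in (shift_pow (s * b) \<omega>, shift_pow (s * a) \<omega>', (s * b, s * a)))"

definition has_stable_periodic_orbit :: "state \<Rightarrow> bool" where
  "has_stable_periodic_orbit = (\<lambda>(\<omega>, \<omega>', v).
     \<exists>n\<ge>1. \<exists>U U'. openin (top_of_set Omega) U \<and> \<omega> \<in> U \<and>
       openin (top_of_set Omega) U' \<and> \<omega>' \<in> U' \<and>
       (\<forall>\<eta>\<in>U. \<forall>\<eta>'\<in>U'. (Phi ^^ n) (\<eta>, \<eta>', v) = (\<eta>, \<eta>', v)))"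

definition invariant_measures :: "(int \<Rightarrow> int) measure set" where
  "invariant_measures =
     {\<mu>. sets \<mu> = sets Omega_borel \<and> prob_space \<mu> \<and> distr \<mu> Omega_borel shift = \<mu>}"

definition ergodic_measures :: "(int \<Rightarrow> int) measure set" where
  "ergodic_measures =
     {\<nu> \<in> invariant_measures. \<forall>A\<in>sets Omega_borel.
        shift -` A \<inter> Omega = A \<longrightarrow> measure \<nu> A = 0 \<or> measure \<nu> A = 1}"

text \<open>The \<open>\<sigma>\<close>-algebra on the space of invariant measures is generated by the evaluations
  \<open>\<nu> \<mapsto> \<nu> A\<close>; as \<open>Omega\<close> is compact and metrizable, it is the Borel \<open>\<sigma>\<close>-algebra of the
  weak-* topology.  No measurability of \<open>ergodic_measures\<close> is presupposed below: a set of
  \<open>emeasure\<close> 1 is measurable.\<close>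

definition is_ergodic_decomposition ::
  "(int \<Rightarrow> int) measure \<Rightarrow> (int \<Rightarrow> int) measure measure \<Rightarrow> bool" where
  "is_ergodic_decomposition \<mu> \<Lambda> \<longleftrightarrow>
     sets \<Lambda> = sets (restrict_space (prob_algebra Omega_borel) invariant_measures) \<and>
     prob_space \<Lambda> \<and>
     emeasure \<Lambda> ergodic_measures = 1 \<and>
     (\<forall>f :: (int \<Rightarrow> int) \<Rightarrow> real. continuous_on Omega f \<longrightarrow>
        (LINT \<omega>|\<mu>. f \<omega>) = (LINT \<nu>:ergodic_measures|\<Lambda>. (LINT \<omega>|\<nu>. f \<omega>)))"

lemma shift_pow_apply: "shift_pow k \<omega> n = \<omega> (n + k)"
proof -
  have pos: "(shift ^^ m) \<omega> = (\<lambda>n. \<omega> (n + int m))" for m \<omega>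
    by (induction m) (auto simp: shift_def algebra_simps)
  have "inv shift = (\<lambda>\<omega> n. \<omega> (n - 1))"
    by (rule inv_equality) (auto simp: shift_def)
  then have "(inv shift ^^ m) \<omega> = (\<lambda>n. \<omega> (n - int m))" for m \<omega>
    by (induction m) (auto simp: algebra_simps)
  with pos show ?thesis
    by (simp add: shift_pow_def)
qed

lemma Phi_in_X_space: "p \<in> X_space \<Longrightarrow> Phi p \<in> X_space"
proof -
  assume "p \<in> X_space"
  then obtain \<omega> \<omega>' a b where p: "p = (\<omega>, \<omega>', a, b)" "\<omega> \<in> Omega" "\<omega>' \<in> Omega" "(a, b) \<in> N_dirs"
    by (auto simp: X_space_def)
  define s where "s = \<omega> 0 * \<omega>' 0"
  have "s = 1 \<or> s = -1"
  proof -
    have "\<omega> 0 = 1 \<or> \<omega> 0 = -1" "\<omega>' 0 = 1 \<or> \<omega>' 0 = -1"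
      using p(2,3) by (simp_all add: Omega_def)
    then show ?thesis
      unfolding s_def by (elim disjE) simp_all
  qed
  then have "(s * b, s * a) \<in> N_dirs"
    using p(4) by (auto simp: N_dirs_def)
  moreover have "Phi p = (shift_pow (s * b) \<omega>, shift_pow (s * a) \<omega>', (s * b, s * a))"
    by (simp add: Phi_def p(1) s_def Let_def)
  ultimately show ?thesis
    using p(2,3) by (auto simp: X_space_def Omega_def shift_pow_apply)
qed

lemma no_stable_periodic_orbit_measurable:
  assumes "sets \<mu> = sets Omega_borel" "sets \<mu>' = sets Omega_borel"
  shows "{p \<in> X_space. \<not> has_stable_periodic_orbit p} \<in> sets (\<mu> \<Otimes>\<^sub>M \<mu>' \<Otimes>\<^sub>M mu_N)"
proof -
  let ?M = "Omega_borel \<Otimes>\<^sub>M Omega_borel \<Otimes>\<^sub>M mu_N"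
  have eq: "sets (\<mu> \<Otimes>\<^sub>M \<mu>' \<Otimes>\<^sub>M mu_N) = sets ?M"
    using assms by (intro sets_pair_measure_cong refl) auto
  have sp: "space Omega_borel = Omega" "space mu_N = N_dirs"
    by (simp_all add: Omega_borel_def mu_N_def space_restrict_space space_uniform_count_measure)
  have spM: "space ?M = X_space"
    by (simp add: space_pair_measure sp X_space_def)
  define W where "W v = \<Union>{T \<times> T' | T T'. open T \<and> open T' \<and>
     (\<exists>n\<ge>1. \<forall>\<eta>\<in>Omega \<inter> T. \<forall>\<eta>'\<in>Omega \<inter> T'. (Phi ^^ n) (\<eta>, \<eta>', v) = (\<eta>, \<eta>', v))}" for v
  have W: "open (W v)" for v
    unfolding W_def by (intro open_Union) (auto intro: open_Times)
  have st: "has_stable_periodic_orbit (\<omega>, \<omega>', v) \<longleftrightarrow> (\<omega>, \<omega>') \<in> W v"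
    if "\<omega> \<in> Omega" "\<omega>' \<in> Omega" for \<omega> \<omega>' v
  proof
    assume "has_stable_periodic_orbit (\<omega>, \<omega>', v)"
    then obtain T T' n where "open T" "\<omega> \<in> T" "open T'" "\<omega>' \<in> T'" "n \<ge> 1"
      "\<forall>\<eta>\<in>Omega \<inter> T. \<forall>\<eta>'\<in>Omega \<inter> T'. (Phi ^^ n) (\<eta>, \<eta>', v) = (\<eta>, \<eta>', v)"
      unfolding has_stable_periodic_orbit_def openin_open prod.case by blast
    then show "(\<omega>, \<omega>') \<in> W v"
      unfolding W_def by blast
  next
    assume "(\<omega>, \<omega>') \<in> W v"
    then obtain T T' n where "\<omega> \<in> T" "\<omega>' \<in> T'" "open T" "open T'" "n \<ge> 1"
      "\<forall>\<eta>\<in>Omega \<inter> T. \<forall>\<eta>'\<in>Omega \<inter> T'. (Phi ^^ n) (\<eta>, \<eta>', v) = (\<eta>, \<eta>', v)"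
      unfolding W_def by blast
    with that show "has_stable_periodic_orbit (\<omega>, \<omega>', v)"
      unfolding has_stable_periodic_orbit_def openin_open prod.case
      by (intro exI[of _ n] exI[of _ "Omega \<inter> T"] exI[of _ "Omega \<inter> T'"]) blast
  qed
  have emb: "(\<lambda>\<omega>. \<omega>) \<in> measurable Omega_borel borel"
    unfolding Omega_borel_def by (rule measurable_restrict_space1) simp
  have "(\<lambda>p. (fst p, fst (snd p))) \<in> measurable ?M (borel \<Otimes>\<^sub>M borel)"
    by (intro measurable_Pair measurable_compose[OF measurable_fst emb]
        measurable_compose[OF measurable_compose[OF measurable_snd measurable_fst] emb])
  then have proj: "(\<lambda>p. (fst p, fst (snd p))) \<in> borel_measurable ?M"
    by (simp add: borel_prod)
  have v: "(\<lambda>p. snd (snd p)) \<in> measurable ?M (count_space N_dirs)"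
  proof -
    have "(\<lambda>p. snd (snd p)) \<in> measurable ?M mu_N"
      by (rule measurable_compose[OF measurable_snd measurable_snd])
    moreover have "sets mu_N = sets (count_space N_dirs)"
      by (simp add: mu_N_def sets_uniform_count_measure)
    ultimately show ?thesis
      using measurable_cong_sets by blast
  qed
  have "{p \<in> X_space. has_stable_periodic_orbit p} =
      (\<Union>v\<in>N_dirs. ((\<lambda>p. (fst p, fst (snd p))) -` W v \<inter> space ?M) \<inter> ((\<lambda>p. snd (snd p)) -` {v} \<inter> space ?M))"
    unfolding spM by (auto simp: X_space_def st)
  also have "\<dots> \<in> sets ?M"
    using W by (intro sets.finite_UN sets.Int measurable_sets[OF proj] measurable_sets[OF v])
      (auto simp: N_dirs_def)
  finally have "space ?M - {p \<in> X_space. has_stable_periodic_orbit p} \<in> sets ?M"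
    by auto
  also have "space ?M - {p \<in> X_space. has_stable_periodic_orbit p} = {p \<in> X_space. \<not> has_stable_periodic_orbit p}"
    unfolding spM by auto
  finally show ?thesis
    unfolding eq .
qed

end

theory Submission
  imports Defs
begin

text \<open>Read \<open>Phi\<close> as a walk on the square lattice in which \<open>\<omega>\<close> belongs to the columns and \<open>\<omega>'\<close> to
  the rows.  Horizontal and vertical steps alternate, and up to one global sign a step in column
  \<open>x\<close> goes in direction \<open>\<omega> x\<close> and a step in row \<open>y\<close> in direction \<open>\<omega>' y\<close>.  Stable periodicity
  forces the walk to close up, so after crossing a fixed horizontal line it must cross that line
  again, in the opposite direction.  Fix a typical \<open>\<omega>'\<close>.  Sending a crossing to the next one is
  then a shift-equivariant injection \<open>x \<mapsto> z\<close> of the columns with \<open>\<omega> z = - \<omega> x\<close>, and mass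
  transport gives \<open>\<nu> {\<omega> 0 = 1} = \<nu> {\<omega> 0 = -1}\<close> for every invariant \<open>\<nu>\<close> for which almost all
  \<open>\<omega>\<close> have this recurrence.  Almost all ergodic components are such \<open>\<nu>\<close>.  The second claim
  follows by exchanging the two coordinates.\<close>

section \<open>First returns\<close>

lemma funpow_intertwine:
  assumes "\<And>x. g (h x) = h (f x)"
  shows "(g ^^ n) (h x) = h ((f ^^ n) x)"
  by (induction n) (simp_all add: assms)

definition first_return :: "('a \<Rightarrow> 'a) \<Rightarrow> 'a set \<Rightarrow> 'a \<Rightarrow> 'a \<Rightarrow> bool" where
  "first_return f A x y \<longleftrightarrow>
     y \<in> A \<and> (\<exists>n>0. (f ^^ n) x = y \<and> (\<forall>k. 0 < k \<longrightarrow> k < n \<longrightarrow> (f ^^ k) x \<notin> A))"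

lemma first_return_left_unique:
  assumes "inj f" "x \<in> A" "y \<in> A" and x: "first_return f A x z" and y: "first_return f A y z"
  shows "x = y"
proof -
  have later_start: "u = v"
    if "(f ^^ m) u = (f ^^ n) v" "0 < m" "m \<le> n" "u \<in> A"
      and avoid: "\<forall>k. 0 < k \<longrightarrow> k < n \<longrightarrow> (f ^^ k) v \<notin> A" for u v m n
  proof -
    have "(f ^^ m) u = (f ^^ m) ((f ^^ (n - m)) v)"
      using that(1,3) funpow_add[of m "n - m" f] by simp
    then have u: "u = (f ^^ (n - m)) v"
      using inj_fn[OF assms(1)] by (simp add: inj_eq)
    then have "n - m = 0"
      using avoid that by (metis diff_less gr0I less_le_trans)
    with u show ?thesis
      by simp
  qed
  from x y show ?thesis
    unfolding first_return_def using later_start assms(2,3) by (metis nle_le)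
qed

lemma first_return_exists:
  assumes "0 < n" "(f ^^ n) x \<in> A"
  shows "\<exists>y. first_return f A x y"
proof -
  obtain m where "0 < m" "(f ^^ m) x \<in> A" "\<forall>k<m. \<not> (0 < k \<and> (f ^^ k) x \<in> A)"
    using assms exists_least_iff[of "\<lambda>k. 0 < k \<and> (f ^^ k) x \<in> A"] by blast
  then show ?thesis
    unfolding first_return_def by blast
qed

lemma first_return_conjugate_iff:
  assumes "inj h" and intertwine: "\<And>x. g (h x) = h (f x)"
  shows "first_return g (h ` A) (h x) (h y) \<longleftrightarrow> first_return f A x y"
  using assms(1)
  by (simp add: first_return_def funpow_intertwine[of g h f, OF intertwine] inj_image_mem_iff
      inj_eq)

definition crossings :: "('a \<Rightarrow> 'a) \<Rightarrow> 'a set \<Rightarrow> 'a set" where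
  "crossings f H = {x. f x \<in> H \<longleftrightarrow> x \<notin> H}"

lemma funpow_mem_iff_of_no_crossings:
  assumes "0 < n" and "\<And>k. 0 < k \<Longrightarrow> k < n \<Longrightarrow> (f ^^ k) x \<notin> crossings f H"
  shows "(f ^^ n) x \<in> H \<longleftrightarrow> f x \<in> H"
  using assms
proof (induction n rule: nat_induct_non_zero)
  case (Suc n)
  from Suc.prems[of n] Suc.hyps have "(f ^^ Suc n) x \<in> H \<longleftrightarrow> (f ^^ n) x \<in> H"
    by (auto simp: crossings_def)
  with Suc show ?case
    by simp
qed simp

lemma first_return_crossings_other_side:
  assumes "x \<in> crossings f H" "first_return f (crossings f H) x y"
  shows "y \<in> H \<longleftrightarrow> x \<notin> H"
  using assms funpow_mem_iff_of_no_crossings[where f=f and x=x and H=H]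
  by (auto simp: first_return_def crossings_def)

lemma first_return_crossings_exists:
  assumes x: "x \<in> crossings f H" and n: "0 < n" "(f ^^ n) x \<in> H \<longleftrightarrow> x \<in> H"
  shows "\<exists>y. first_return f (crossings f H) x y"
proof (rule ccontr)
  assume "\<not> ?thesis"
  then have "(f ^^ n) x \<in> H \<longleftrightarrow> f x \<in> H"
    using first_return_exists[of _ f x] by (intro funpow_mem_iff_of_no_crossings n) blast
  with x n show False
    by (simp add: crossings_def)
qed

section \<open>Mass transport\<close>

lemma mass_transport:
  fixes M :: "'a measure" and T :: "'g::{countable, group_add} \<Rightarrow> 'a \<Rightarrow> 'a"
    and F :: "'a \<Rightarrow> 'g \<Rightarrow> 'g \<Rightarrow> ennreal"
  assumes T_measurable [measurable]: "\<And>g. T g \<in> measurable M M"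
    and invariant: "\<And>g. distr M M (T g) = M"
    and F_measurable [measurable]: "\<And>z. (\<lambda>\<omega>. F \<omega> 0 z) \<in> borel_measurable M"
    and equivariant: "\<And>\<omega> g x z. F (T g \<omega>) x z = F \<omega> (x + g) (z + g)"
  shows "(\<integral>\<^sup>+\<omega>. \<integral>\<^sup>+z. F \<omega> 0 z \<partial>count_space UNIV \<partial>M) = (\<integral>\<^sup>+\<omega>. \<integral>\<^sup>+x. F \<omega> x 0 \<partial>count_space UNIV \<partial>M)"
proof -
  have to_origin: "F \<omega> x 0 = F (T x \<omega>) 0 (- x)" for \<omega> x
    by (simp add: equivariant)
  then have arrival_measurable: "(\<lambda>\<omega>. F \<omega> x 0) \<in> borel_measurable M" for x
    by simp
  have "(\<integral>\<^sup>+\<omega>. F \<omega> x 0 \<partial>M) = (\<integral>\<^sup>+\<omega>. F \<omega> 0 (- x) \<partial>distr M M (T x))" for x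
    by (simp add: to_origin nn_integral_distr)
  then have origin: "(\<integral>\<^sup>+\<omega>. F \<omega> x 0 \<partial>M) = (\<integral>\<^sup>+\<omega>. F \<omega> 0 (- x) \<partial>M)" for x
    by (simp add: invariant)
  have "(\<integral>\<^sup>+\<omega>. \<integral>\<^sup>+z. F \<omega> 0 z \<partial>count_space UNIV \<partial>M) = (\<integral>\<^sup>+z. \<integral>\<^sup>+\<omega>. F \<omega> 0 z \<partial>M \<partial>count_space UNIV)"
    by (intro nn_integral_count_space_nn_integral) auto
  also have "\<dots> = (\<integral>\<^sup>+x. \<integral>\<^sup>+\<omega>. F \<omega> 0 (- x) \<partial>M \<partial>count_space UNIV)"
    by (rule nn_integral_bij_count_space[symmetric]) (rule bij_uminus)
  also have "\<dots> = (\<integral>\<^sup>+\<omega>. \<integral>\<^sup>+x. F \<omega> x 0 \<partial>count_space UNIV \<partial>M)"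
    unfolding origin[symmetric] using arrival_measurable
    by (intro nn_integral_count_space_nn_integral[symmetric]) auto
  finally show ?thesis .
qed

lemma emeasure_le_of_equivariant_matching:
  fixes M :: "'a measure" and T :: "'g::{countable, group_add} \<Rightarrow> 'a \<Rightarrow> 'a"
    and R :: "'a \<Rightarrow> 'g \<Rightarrow> 'g \<Rightarrow> bool"
  assumes "\<And>g. T g \<in> measurable M M" "\<And>g. distr M M (T g) = M"
    and R_measurable: "\<And>z. Measurable.pred M (\<lambda>\<omega>. R \<omega> 0 z)"
    and equivariant: "\<And>\<omega> g x z. R (T g \<omega>) x z \<longleftrightarrow> R \<omega> (x + g) (z + g)"
    and left_unique: "\<And>\<omega> x y z. R \<omega> x z \<Longrightarrow> R \<omega> y z \<Longrightarrow> x = y"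
    and A_sets: "A \<in> sets M" and departs: "AE \<omega> in M. \<omega> \<in> A \<longrightarrow> (\<exists>z. R \<omega> 0 z)"
    and B_sets: "B \<in> sets M" and arrives: "\<And>\<omega> x. \<omega> \<in> space M \<Longrightarrow> R \<omega> x 0 \<Longrightarrow> \<omega> \<in> B"
  shows "emeasure M A \<le> emeasure M B"
proof -
  define F :: "'a \<Rightarrow> 'g \<Rightarrow> 'g \<Rightarrow> ennreal" where "F \<omega> x z = (if R \<omega> x z then 1 else 0)" for \<omega> x z
  have "AE \<omega> in M. indicator A \<omega> \<le> (\<integral>\<^sup>+z. F \<omega> 0 z \<partial>count_space UNIV)"
    using departs
  proof eventually_elim
    case (elim \<omega>)
    have "indicator A \<omega> \<le> F \<omega> 0 z" if "\<omega> \<in> A \<longrightarrow> R \<omega> 0 z" for z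
      using that by (auto simp: F_def indicator_def)
    with elim show ?case
      by (meson UNIV_I nn_integral_ge_point order_trans)
  qed
  then have "emeasure M A \<le> (\<integral>\<^sup>+\<omega>. \<integral>\<^sup>+z. F \<omega> 0 z \<partial>count_space UNIV \<partial>M)"
    unfolding nn_integral_indicator[OF A_sets, symmetric] by (rule nn_integral_mono_AE)
  also have "\<dots> = (\<integral>\<^sup>+\<omega>. \<integral>\<^sup>+x. F \<omega> x 0 \<partial>count_space UNIV \<partial>M)"
    using R_measurable by (intro mass_transport[of T] assms(1,2)) (simp_all add: F_def equivariant)
  also have "\<dots> \<le> (\<integral>\<^sup>+\<omega>. indicator B \<omega> \<partial>M)"
  proof (rule nn_integral_mono)
    fix \<omega>
    assume \<omega>: "\<omega> \<in> space M"
    show "(\<integral>\<^sup>+x. F \<omega> x 0 \<partial>count_space UNIV) \<le> indicator B \<omega>"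
    proof (cases "\<exists>x. R \<omega> x 0")
      case True
      then obtain x where x: "R \<omega> x 0"
        by blast
      then have "F \<omega> y 0 = indicator {x} y" for y
        using left_unique[OF _ x, of y] by (cases "y = x") (auto simp: F_def)
      with arrives[OF \<omega> x] show ?thesis
        by simp
    qed (simp add: F_def)
  qed
  finally show ?thesis
    by (simp add: B_sets)
qed

section \<open>Products of discrete spaces\<close>

lemma open_fun_finite_coordinates:
  fixes f :: "'i \<Rightarrow> 'b::topological_space"
  assumes "open V" "f \<in> V"
  obtains F where "finite F" and "\<And>g. (\<And>i. i \<in> F \<Longrightarrow> g i = f i) \<Longrightarrow> g \<in> V"
proof -
  obtain W where W: "f \<in> Pi\<^sub>E UNIV W" "finite {i. W i \<noteq> UNIV}" "Pi\<^sub>E UNIV W \<subseteq> V"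
    using product_topology_open_contains_basis[of "\<lambda>_. euclidean" UNIV V f] assms
    by (auto simp: open_fun_def)
  have "g \<in> V" if "\<And>i. W i \<noteq> UNIV \<Longrightarrow> g i = f i" for g
  proof -
    have "g i \<in> W i" for i
      using that[of i] W(1) by (cases "W i = UNIV") (auto simp: PiE_iff)
    with W(3) show ?thesis
      by auto
  qed
  with W(2) show thesis
    by (intro that[of "{i. W i \<noteq> UNIV}"]) auto
qed

lemma sets_borel_clopen:
  "sets (borel :: ('i::countable \<Rightarrow> 'b::{second_countable_topology, discrete_topology}) measure) =
     sigma_sets UNIV {U. open U \<and> closed U}"
proof
  have open_coordinate: "open {f :: 'i \<Rightarrow> 'b. f i \<in> A}" for i A
    using open_vimage[OF Topological_Spaces.open_discrete[of A]
        continuous_on_product_coordinates[of i]]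
    by (simp add: vimage_def)
  have closed_coordinate: "closed {f :: 'i \<Rightarrow> 'b. f i \<in> A}" for i A
    unfolding closed_def Collect_neg_eq[symmetric] using open_coordinate[of i "- A"] by simp
  have "sets (borel :: ('i \<Rightarrow> 'b) measure) = sigma_sets UNIV {{f. f i \<in> A} | i A. A \<in> sets borel}"
    unfolding sets_PiM_equal_borel[symmetric] sets_PiM_single by (simp add: PiE_UNIV_domain)
  also have "\<dots> \<subseteq> sigma_sets UNIV {U. open U \<and> closed U}"
    using open_coordinate closed_coordinate by (intro sigma_sets_mono') blast
  finally show "sets (borel :: ('i \<Rightarrow> 'b) measure) \<subseteq> sigma_sets UNIV {U. open U \<and> closed U}" .
  have "{U. open U \<and> closed U} \<subseteq> sets (borel :: ('i \<Rightarrow> 'b) measure)"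
    by auto
  from sets.sigma_sets_subset[OF this]
  show "sigma_sets UNIV {U. open U \<and> closed U} \<subseteq> sets (borel :: ('i \<Rightarrow> 'b) measure)"
    by simp
qed

lemma sets_restrict_space_borel_clopen:
  fixes S :: "('i::countable \<Rightarrow> 'b::{second_countable_topology, discrete_topology}) set"
  shows "sets (restrict_space borel S) = sigma_sets S ((\<lambda>U. U \<inter> S) ` {U. open U \<and> closed U})"
proof -
  have "sets (restrict_space borel S) =
      sets (vimage_algebra S (\<lambda>f. f) (sigma UNIV {U. open U \<and> closed U}))"
    by (subst restrict_space_eq_vimage_algebra)
      (auto intro!: sets_vimage_algebra_cong simp: sets_borel_clopen)
  also have "\<dots> = sets (sigma S {(\<lambda>f. f) -` U \<inter> S | U. U \<in> {U. open U \<and> closed U}})"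
    by (subst vimage_algebra_sigma) auto
  also have "{(\<lambda>f. f) -` U \<inter> S | U. U \<in> {U. open U \<and> closed U}} = (\<lambda>U. U \<inter> S) ` {U. open U \<and> closed U}"
    by auto
  finally show ?thesis
    by (simp add: image_subset_iff)
qed

lemma measure_eqI_clopen:
  fixes M N :: "('i::countable \<Rightarrow> 'b::{second_countable_topology, discrete_topology}) measure"
  assumes sets: "sets M = sets (restrict_space borel S)" "sets N = sets (restrict_space borel S)"
    and finite: "finite_measure M" "finite_measure N"
    and clopen: "\<And>U. open U \<Longrightarrow> closed U \<Longrightarrow> measure M (U \<inter> S) = measure N (U \<inter> S)"
  shows "M = N"
proof (rule measure_eqI_generator_eq)
  let ?E = "(\<lambda>U. U \<inter> S) ` {U. open U \<and> closed U}"
  show "Int_stable ?E"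
  proof (rule Int_stableI_image)
    show "\<exists>W\<in>{U. open U \<and> closed U}. (U \<inter> S) \<inter> (V \<inter> S) = W \<inter> S"
      if "U \<in> {U. open U \<and> closed U}" "V \<in> {U. open U \<and> closed U}" for U V
      using that by (intro bexI[of _ "U \<inter> V"]) auto
  qed
  show "emeasure M A = emeasure N A" if "A \<in> ?E" for A
    using that clopen by (auto simp: finite[THEN finite_measure.emeasure_eq_measure])
  show "range (\<lambda>_::nat. S) \<subseteq> ?E"
    by (auto intro!: image_eqI[of _ _ UNIV])
qed (auto simp: sets sets_restrict_space_borel_clopen finite_measure.emeasure_finite[OF finite(1)])

lemma continuous_on_indicator_clopen:
  assumes "open U" "closed U"
  shows "continuous_on S (indicator U :: 'a::topological_space \<Rightarrow> real)"
proof -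
  have "continuous_on U (indicator U :: 'a \<Rightarrow> real)" "continuous_on (- U) (indicator U :: 'a \<Rightarrow> real)"
    by (auto intro: continuous_on_eq[OF continuous_on_const])
  then have "continuous_on (U \<union> - U) (indicator U :: 'a \<Rightarrow> real)"
    using assms by (intro continuous_on_closed_Un) (simp_all add: closed_Compl)
  then show ?thesis
    by (rule continuous_on_subset) simp
qed

section \<open>The walk\<close>

lemma OmegaD: "\<omega> \<in> Omega \<Longrightarrow> \<omega> n = 1 \<or> \<omega> n = -1"
  by (simp add: Omega_def)

lemma shift_pow_shift_pow: "shift_pow k (shift_pow l \<omega>) = shift_pow (k + l) \<omega>"
  by (rule ext) (simp add: shift_pow_apply algebra_simps)

lemma shift_pow_0 [simp]: "shift_pow 0 \<omega> = \<omega>"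
  by (rule ext) (simp add: shift_pow_apply)

lemma shift_pow_in_Omega: "\<omega> \<in> Omega \<Longrightarrow> shift_pow k \<omega> \<in> Omega"
  by (simp add: Omega_def shift_pow_apply)

text \<open>Two applications of \<open>Phi\<close>, with the global sign normalised to \<open>1\<close>.\<close>

definition corner_step :: "(int \<Rightarrow> int) \<Rightarrow> (int \<Rightarrow> int) \<Rightarrow> int \<times> int \<Rightarrow> int \<times> int" where
  "corner_step \<omega> \<omega>' = (\<lambda>(x, y). (x + \<omega>' (y + \<omega> x), y + \<omega> x))"

definition walk_state :: "(int \<Rightarrow> int) \<Rightarrow> (int \<Rightarrow> int) \<Rightarrow> int \<times> int \<Rightarrow> state" where
  "walk_state \<omega> \<omega>' = (\<lambda>(x, y). (shift_pow x \<omega>, shift_pow y \<omega>', (\<omega>' y, 0)))"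

lemma inj_corner_step: "inj (corner_step \<omega> \<omega>')"
  by (auto simp: inj_on_def corner_step_def)

lemma Phi_Phi_walk_state:
  assumes "\<omega> \<in> Omega" "\<omega>' \<in> Omega"
  shows "Phi (Phi (walk_state \<omega> \<omega>' p)) = walk_state \<omega> \<omega>' (corner_step \<omega> \<omega>' p)"
proof -
  obtain x y where p: "p = (x, y)"
    by fastforce
  have "\<omega> n * \<omega> n = 1" "\<omega>' n * \<omega>' n = 1" for n
    using OmegaD[OF assms(1), of n] OmegaD[OF assms(2), of n] by auto
  then have sign_cancel: "\<omega> n * (\<omega> n * m) = m" "\<omega>' n * (\<omega>' n * m) = m" "\<omega>' n * \<omega>' n = 1" for n m
    by (simp_all flip: mult.assoc)
  have "Phi (walk_state \<omega> \<omega>' p) = (shift_pow x \<omega>, shift_pow (y + \<omega> x) \<omega>', (0, \<omega> x))"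
    by (simp add: p walk_state_def Phi_def Let_def shift_pow_apply shift_pow_shift_pow sign_cancel
        ac_simps)
  also have "Phi \<dots> = walk_state \<omega> \<omega>' (corner_step \<omega> \<omega>' p)"
    by (simp add: p walk_state_def corner_step_def Phi_def Let_def shift_pow_apply
        shift_pow_shift_pow sign_cancel ac_simps)
  finally show ?thesis .
qed

lemma Phi_funpow_walk_state:
  assumes "\<omega> \<in> Omega" "\<omega>' \<in> Omega"
  shows "(Phi ^^ (2 * n)) (walk_state \<omega> \<omega>' p) = walk_state \<omega> \<omega>' ((corner_step \<omega> \<omega>' ^^ n) p)"
proof -
  have "((Phi ^^ 2) ^^ n) (walk_state \<omega> \<omega>' p) = walk_state \<omega> \<omega>' ((corner_step \<omega> \<omega>' ^^ n) p)"
    by (rule funpow_intertwine) (simp add: numeral_2_eq_2 Phi_Phi_walk_state[OF assms])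
  then show ?thesis
    by (simp add: funpow_mult)
qed

lemma corner_step_translate:
  "corner_step (shift_pow k \<omega>) (shift_pow l \<omega>') (p - (k, l)) = corner_step \<omega> \<omega>' p - (k, l)"
  by (cases p) (simp add: corner_step_def shift_pow_apply algebra_simps)

lemma corner_step_funpow_cong:
  assumes "\<And>k. k \<le> n \<Longrightarrow>
    \<eta> (snd ((corner_step \<omega> \<omega>' ^^ k) p)) = \<omega>' (snd ((corner_step \<omega> \<omega>' ^^ k) p))"
  shows "(corner_step \<omega> \<eta> ^^ n) p = (corner_step \<omega> \<omega>' ^^ n) p"
  using assms
proof (induction n)
  case (Suc n)
  obtain x y where "(corner_step \<omega> \<omega>' ^^ n) p = (x, y)"
    by fastforce
  with Suc.IH Suc.prems[of "Suc n"] Suc.prems show ?case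
    by (simp add: corner_step_def)
qed simp

section \<open>Stable periodicity forces recurrence\<close>

lemma openin_Omega_flip:
  assumes "openin (top_of_set Omega) U" "\<eta> \<in> U" "finite R"
  obtains j where "j \<notin> R" "\<eta>(j := - \<eta> j) \<in> U"
proof -
  obtain V where V: "open V" "U = Omega \<inter> V"
    using assms(1) unfolding openin_open by blast
  obtain F where F: "finite F" "\<And>\<gamma>. (\<And>i. i \<in> F \<Longrightarrow> \<gamma> i = \<eta> i) \<Longrightarrow> \<gamma> \<in> V"
    using open_fun_finite_coordinates[OF V(1), of \<eta>] assms(2) V(2) by auto
  obtain j where j: "j \<notin> F \<union> R"
    using ex_new_if_finite[OF infinite_UNIV_int] F(1) assms(3) by blast
  have "\<eta>(j := - \<eta> j) \<in> Omega"
    using assms(2) V(2) by (auto simp: Omega_def)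
  moreover have "\<eta>(j := - \<eta> j) \<in> V"
    using j by (intro F(2)) auto
  ultimately show thesis
    using j that V(2) by blast
qed

lemma shift_pow_fixed_flip_imp_zero:
  assumes "shift_pow k \<eta> = \<eta>" "shift_pow k (\<eta>(j := - \<eta> j)) = \<eta>(j := - \<eta> j)" "\<eta> j \<noteq> 0"
  shows "k = 0"
  using fun_cong[OF assms(1), of j] fun_cong[OF assms(2), of j] assms(3)
  by (auto simp: shift_pow_apply split: if_splits)

text \<open>If the walk came back displaced vertically by \<open>k \<noteq> 0\<close>, then all vertical sequences near
  \<open>\<omega>'\<close> would be \<open>k\<close>-periodic; changing a single entry that the walk does not see refutes this.\<close>

lemma stable_imp_returns_to_row:
  assumes \<omega>: "\<omega> \<in> Omega" and \<omega>': "\<omega>' \<in> Omega"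
    and stable: "has_stable_periodic_orbit (\<omega>, \<omega>', (\<omega>' 0, 0))"
  shows "\<exists>n>0. snd ((corner_step \<omega> \<omega>' ^^ n) (0, 0)) = 0"
proof -
  let ?row = "\<lambda>k. snd ((corner_step \<omega> \<omega>' ^^ k) (0, 0))"
  obtain n U U' where n: "n \<ge> 1" and "\<omega> \<in> U"
    and U': "openin (top_of_set Omega) U'" "\<omega>' \<in> U'"
    and "\<forall>\<eta>\<in>U. \<forall>\<eta>'\<in>U'. (Phi ^^ n) (\<eta>, \<eta>', (\<omega>' 0, 0)) = (\<eta>, \<eta>', (\<omega>' 0, 0))"
    using stable unfolding has_stable_periodic_orbit_def prod.case by blast
  then have periodic: "(Phi ^^ (2 * n)) (\<omega>, \<eta>', (\<omega>' 0, 0)) = (\<omega>, \<eta>', (\<omega>' 0, 0))" if "\<eta>' \<in> U'" for \<eta>'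
    using that by (simp add: mult_2 funpow_add)
  have fixed: "shift_pow (?row n) \<eta> = \<eta>" if "\<eta> \<in> U'" "\<And>k. k \<le> n \<Longrightarrow> \<eta> (?row k) = \<omega>' (?row k)" for \<eta>
  proof -
    have "\<eta> \<in> Omega"
      using openin_imp_subset[OF U'(1)] that(1) by blast
    have "walk_state \<omega> \<eta> (0, 0) = (\<omega>, \<eta>, (\<omega>' 0, 0))"
      using that(2)[of 0] by (simp add: walk_state_def)
    then have "walk_state \<omega> \<eta> ((corner_step \<omega> \<eta> ^^ n) (0, 0)) = (\<omega>, \<eta>, (\<omega>' 0, 0))"
      using periodic[OF that(1)] Phi_funpow_walk_state[OF \<omega> \<open>\<eta> \<in> Omega\<close>] by metis
    moreover have "(corner_step \<omega> \<eta> ^^ n) (0, 0) = (corner_step \<omega> \<omega>' ^^ n) (0, 0)"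
      by (rule corner_step_funpow_cong) (rule that(2))
    ultimately show ?thesis
      by (simp add: walk_state_def split_beta)
  qed
  obtain j where j: "j \<notin> ?row ` {..n}" "\<omega>'(j := - \<omega>' j) \<in> U'"
    by (rule openin_Omega_flip[OF U' finite_imageI[OF finite_atMost]])
  have "shift_pow (?row n) (\<omega>'(j := - \<omega>' j)) = \<omega>'(j := - \<omega>' j)"
    using j by (intro fixed) auto
  with fixed[OF U'(2)] have "?row n = 0"
    by (rule shift_pow_fixed_flip_imp_zero) (use OmegaD[OF \<omega>', of j] in auto)
  with n show ?thesis
    by (intro exI[of _ n]) simp
qed

definition row_recurrent :: "(int \<Rightarrow> int) \<Rightarrow> (int \<Rightarrow> int) \<Rightarrow> bool" where
  "row_recurrent \<omega> \<omega>' \<longleftrightarrow> (\<forall>p. \<exists>n>0. snd ((corner_step \<omega> \<omega>' ^^ n) p) = snd p)"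

definition stable_in_all_directions :: "(int \<Rightarrow> int) \<Rightarrow> (int \<Rightarrow> int) \<Rightarrow> bool" where
  "stable_in_all_directions \<omega> \<omega>' \<longleftrightarrow> (\<forall>v\<in>N_dirs. has_stable_periodic_orbit (\<omega>, \<omega>', v))"

lemma stable_translates_imp_row_recurrent:
  assumes \<omega>: "\<omega> \<in> Omega" and \<omega>': "\<omega>' \<in> Omega"
    and stable: "\<And>x y. stable_in_all_directions (shift_pow x \<omega>) (shift_pow y \<omega>')"
  shows "row_recurrent \<omega> \<omega>'"
  unfolding row_recurrent_def
proof
  fix p :: "int \<times> int"
  obtain x y where p: "p = (x, y)"
    by fastforce
  define \<alpha> \<beta> where "\<alpha> = shift_pow x \<omega>" and "\<beta> = shift_pow y \<omega>'"
  have \<alpha>: "\<alpha> \<in> Omega" and \<beta>: "\<beta> \<in> Omega"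
    using \<omega> \<omega>' by (simp_all add: \<alpha>_def \<beta>_def shift_pow_in_Omega)
  have "(\<beta> 0, 0) \<in> N_dirs"
    using OmegaD[OF \<beta>, of 0] by (auto simp: N_dirs_def)
  then have "has_stable_periodic_orbit (\<alpha>, \<beta>, (\<beta> 0, 0))"
    using stable by (simp add: stable_in_all_directions_def \<alpha>_def \<beta>_def)
  then obtain n where "n > 0" "snd ((corner_step \<alpha> \<beta> ^^ n) (0, 0)) = 0"
    using stable_imp_returns_to_row[OF \<alpha> \<beta>] by blast
  moreover have "(corner_step \<alpha> \<beta> ^^ n) (p - (x, y)) = (corner_step \<omega> \<omega>' ^^ n) p - (x, y)"
    unfolding \<alpha>_def \<beta>_def
    by (rule funpow_intertwine[where h="\<lambda>q. q - (x, y)"]) (rule corner_step_translate)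
  ultimately show "\<exists>n>0. snd ((corner_step \<omega> \<omega>' ^^ n) p) = snd p"
    by (intro exI[of _ n]) (simp add: p zero_prod_def)
qed

definition swap_state :: "state \<Rightarrow> state" where
  "swap_state = (\<lambda>(\<omega>, \<omega>', (a, b)). (\<omega>', \<omega>, (b, a)))"

lemma Phi_swap_state: "Phi (swap_state p) = swap_state (Phi p)"
  by (cases p) (auto simp: Phi_def swap_state_def Let_def mult.commute)

lemma has_stable_periodic_orbit_swap:
  assumes "has_stable_periodic_orbit (\<omega>, \<omega>', (a, b))"
  shows "has_stable_periodic_orbit (\<omega>', \<omega>, (b, a))"
proof -
  obtain n U U' where "n \<ge> 1" "openin (top_of_set Omega) U" "\<omega> \<in> U"
    "openin (top_of_set Omega) U'" "\<omega>' \<in> U'"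
    and periodic: "\<forall>\<eta>\<in>U. \<forall>\<eta>'\<in>U'. (Phi ^^ n) (\<eta>, \<eta>', (a, b)) = (\<eta>, \<eta>', (a, b))"
    using assms unfolding has_stable_periodic_orbit_def prod.case by blast
  moreover have "\<forall>\<eta>'\<in>U'. \<forall>\<eta>\<in>U. (Phi ^^ n) (\<eta>', \<eta>, (b, a)) = (\<eta>', \<eta>, (b, a))"
    using periodic funpow_intertwine[of Phi swap_state Phi n "(_, _, (a, b))", OF Phi_swap_state]
    by (simp add: swap_state_def)
  ultimately show ?thesis
    unfolding has_stable_periodic_orbit_def prod.case by blast
qed

lemma stable_in_all_directions_commute:
  "stable_in_all_directions \<omega> \<omega>' \<longleftrightarrow> stable_in_all_directions \<omega>' \<omega>"
proof -
  have "stable_in_all_directions \<omega>' \<omega>" if "stable_in_all_directions \<omega> \<omega>'" for \<omega> \<omega>'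
    unfolding stable_in_all_directions_def
  proof safe
    fix a b
    assume "(a, b) \<in> N_dirs"
    then have "(b, a) \<in> N_dirs"
      by (auto simp: N_dirs_def)
    with that show "has_stable_periodic_orbit (\<omega>', \<omega>, (a, b))"
      by (simp add: stable_in_all_directions_def has_stable_periodic_orbit_swap[of \<omega> \<omega>' b a])
  qed
  then show ?thesis
    by blast
qed

section \<open>Crossings of a horizontal line\<close>

definition upper_half :: "(int \<times> int) set" where
  "upper_half = {p. 1 \<le> snd p}"

text \<open>The point of column \<open>x\<close> from which the walk crosses the line between the rows \<open>0\<close> and \<open>1\<close>:
  upwards if \<open>\<omega> x = 1\<close> and downwards if \<open>\<omega> x = -1\<close>.\<close>

definition crossing :: "(int \<Rightarrow> int) \<Rightarrow> int \<Rightarrow> int \<times> int" where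
  "crossing \<omega> x = (x, if \<omega> x = 1 then 0 else 1)"

definition next_crossing :: "(int \<Rightarrow> int) \<Rightarrow> (int \<Rightarrow> int) \<Rightarrow> int \<Rightarrow> int \<Rightarrow> bool" where
  "next_crossing \<omega> \<omega>' x z \<longleftrightarrow>
     first_return (corner_step \<omega> \<omega>') (range (crossing \<omega>)) (crossing \<omega> x) (crossing \<omega> z)"

lemma crossing_eq_iff [simp]: "crossing \<omega> x = crossing \<omega> z \<longleftrightarrow> x = z"
  by (auto simp: crossing_def)

lemma range_crossing:
  assumes "\<omega> \<in> Omega"
  shows "range (crossing \<omega>) = crossings (corner_step \<omega> \<omega>') upper_half"
proof (rule set_eqI)
  fix p :: "int \<times> int"
  obtain x y where p: "p = (x, y)"
    by fastforce
  have "p \<in> range (crossing \<omega>) \<longleftrightarrow> y = (if \<omega> x = 1 then 0 else 1)"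
    by (auto simp: crossing_def p)
  with OmegaD[OF assms, of x]
  show "p \<in> range (crossing \<omega>) \<longleftrightarrow> p \<in> crossings (corner_step \<omega> \<omega>') upper_half"
    by (auto simp: crossings_def corner_step_def upper_half_def p)
qed

lemma crossing_in_upper_half_iff: "crossing \<omega> x \<in> upper_half \<longleftrightarrow> \<omega> x \<noteq> 1"
  by (simp add: crossing_def upper_half_def)

lemma next_crossing_left_unique:
  assumes "next_crossing \<omega> \<omega>' x z" "next_crossing \<omega> \<omega>' w z"
  shows "x = w"
  using assms first_return_left_unique[OF inj_corner_step rangeI rangeI]
  unfolding next_crossing_def by (metis crossing_eq_iff)

lemma next_crossing_translate:
  "next_crossing (shift_pow r \<omega>) \<omega>' x z \<longleftrightarrow> next_crossing \<omega> \<omega>' (x + r) (z + r)"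
proof -
  define h :: "int \<times> int \<Rightarrow> int \<times> int" where "h p = p - (r, 0)" for p
  have crossing: "crossing (shift_pow r \<omega>) x = h (crossing \<omega> (x + r))" for x
    by (simp add: crossing_def shift_pow_apply h_def)
  have "range (crossing (shift_pow r \<omega>)) = h ` crossing \<omega> ` range (\<lambda>x. x + r)"
    unfolding crossing image_image ..
  then have range: "range (crossing (shift_pow r \<omega>)) = h ` range (crossing \<omega>)"
    by simp
  have "corner_step (shift_pow r \<omega>) \<omega>' (h p) = h (corner_step \<omega> \<omega>' p)" for p
    using corner_step_translate[of r \<omega> 0 \<omega>' p] by (simp add: h_def)
  moreover have "inj h"
    by (simp add: h_def inj_def)
  ultimately show ?thesis
    unfolding next_crossing_def crossing range by (intro first_return_conjugate_iff)
qed

lemma next_crossing_opposite: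
  assumes "\<omega> \<in> Omega" "next_crossing \<omega> \<omega>' x z"
  shows "\<omega> z = - \<omega> x"
proof -
  have "crossing \<omega> x \<in> crossings (corner_step \<omega> \<omega>') upper_half"
    unfolding range_crossing[OF assms(1), symmetric] by simp
  moreover have "first_return (corner_step \<omega> \<omega>') (crossings (corner_step \<omega> \<omega>') upper_half)
      (crossing \<omega> x) (crossing \<omega> z)"
    using assms(2) unfolding next_crossing_def range_crossing[OF assms(1), of \<omega>'] .
  ultimately have "crossing \<omega> z \<in> upper_half \<longleftrightarrow> crossing \<omega> x \<notin> upper_half"
    by (rule first_return_crossings_other_side)
  with OmegaD[OF assms(1), of x] OmegaD[OF assms(1), of z] show ?thesis
    by (auto simp: crossing_in_upper_half_iff)
qed

lemma next_crossing_exists: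
  assumes \<omega>: "\<omega> \<in> Omega" and "row_recurrent \<omega> \<omega>'"
  shows "\<exists>z. next_crossing \<omega> \<omega>' x z"
proof -
  let ?f = "corner_step \<omega> \<omega>'" and ?p = "crossing \<omega> x"
  obtain n where n: "0 < n" "snd ((?f ^^ n) ?p) = snd ?p"
    using assms(2) unfolding row_recurrent_def by blast
  have "?p \<in> crossings ?f upper_half"
    unfolding range_crossing[OF \<omega>, symmetric] by simp
  then have "\<exists>q. first_return ?f (crossings ?f upper_half) ?p q"
    by (rule first_return_crossings_exists[OF _ n(1)]) (simp add: upper_half_def n(2))
  then obtain q where q: "first_return ?f (range (crossing \<omega>)) ?p q"
    unfolding range_crossing[OF \<omega>, of \<omega>'] by blast
  moreover from q obtain z where "q = crossing \<omega> z"
    by (auto simp: first_return_def)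
  ultimately show ?thesis
    unfolding next_crossing_def by blast
qed

section \<open>Measurability\<close>

lemma measurable_funpow_countable:
  fixes f :: "'a \<Rightarrow> 'b::countable \<Rightarrow> 'b"
  assumes "\<And>y. (\<lambda>x. f x y) \<in> measurable M (count_space UNIV)"
    and e: "e \<in> measurable M (count_space UNIV)"
  shows "(\<lambda>x. (f x ^^ n) (e x)) \<in> measurable M (count_space UNIV)"
proof (induction n)
  case (Suc n)
  then show ?case
    using measurable_compose_countable[OF assms(1) Suc] by simp
qed (simp add: e)

lemma space_Omega_borel [simp]: "space Omega_borel = Omega"
  by (simp add: Omega_borel_def space_restrict_space)

lemma measurable_coordinate [measurable]: "(\<lambda>\<omega>. \<omega> i) \<in> measurable Omega_borel (count_space UNIV)"
proof -
  have "(\<lambda>\<omega>. \<omega> i) \<in> borel_measurable Omega_borel"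
    unfolding Omega_borel_def
    by (intro measurable_restrict_space1 measurable_product_coordinates)
  then show ?thesis
    unfolding measurable_count_space_eq_countable[OF countableI_type]
    using measurable_sets[of "\<lambda>\<omega>. \<omega> i" Omega_borel borel "{_}"] by auto
qed

lemma measurable_shift_pow: "shift_pow k \<in> measurable Omega_borel Omega_borel"
proof -
  have "continuous_on UNIV (shift_pow k)"
    by (intro continuous_on_coordinatewise_then_product) (simp add: shift_pow_apply)
  then show ?thesis
    unfolding Omega_borel_def
    by (intro measurable_restrict_space2 measurable_restrict_space1 borel_measurable_continuous_onI)
      (auto simp: space_restrict_space shift_pow_in_Omega)
qed

lemma measurable_corner_step_funpow:
  assumes "e \<in> measurable Omega_borel (count_space UNIV)"
  shows "(\<lambda>\<omega>. (corner_step \<omega> \<omega>' ^^ n) (e \<omega>)) \<in> measurable Omega_borel (count_space UNIV)"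
proof (rule measurable_funpow_countable[OF _ assms])
  fix p :: "int \<times> int"
  show "(\<lambda>\<omega>. corner_step \<omega> \<omega>' p) \<in> measurable Omega_borel (count_space UNIV)"
    unfolding corner_step_def by (cases p) simp
qed

lemma measurable_crossing: "(\<lambda>\<omega>. crossing \<omega> x) \<in> measurable Omega_borel (count_space UNIV)"
  unfolding crossing_def by measurable

lemma pred_row_recurrent: "Measurable.pred Omega_borel (\<lambda>\<omega>. row_recurrent \<omega> \<omega>')"
proof -
  have [measurable]: "(\<lambda>\<omega>. (corner_step \<omega> \<omega>' ^^ n) p) \<in> measurable Omega_borel (count_space UNIV)"
    for n p
    by (rule measurable_corner_step_funpow) simp
  show ?thesis
    unfolding row_recurrent_def by measurable
qed

lemma pred_next_crossing: "Measurable.pred Omega_borel (\<lambda>\<omega>. next_crossing \<omega> \<omega>' x z)"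
proof -
  note [measurable] = measurable_crossing measurable_corner_step_funpow[OF measurable_crossing]
  have [measurable]: "Measurable.pred Omega_borel (\<lambda>\<omega>. f \<omega> = g \<omega>)"
    if [measurable]: "f \<in> measurable Omega_borel (count_space UNIV)"
      "g \<in> measurable Omega_borel (count_space UNIV)"
    for f g :: "_ \<Rightarrow> int \<times> int"
    by measurable
  show ?thesis
    unfolding next_crossing_def first_return_def image_iff Bex_def by measurable
qed

section \<open>Invariant measures\<close>

lemma invariant_measuresD:
  assumes "\<nu> \<in> invariant_measures"
  shows "sets \<nu> = sets Omega_borel" "space \<nu> = Omega" "prob_space \<nu>"
  using assms sets_eq_imp_space_eq[of \<nu> Omega_borel] by (auto simp: invariant_measures_def)

lemma measurable_invariant_measure:
  assumes "\<nu> \<in> invariant_measures"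
  shows "measurable \<nu> = measurable Omega_borel"
  using measurable_cong_sets[OF invariant_measuresD(1)[OF assms] refl] by blast

lemma measurable_shift_pow_invariant:
  assumes "\<nu> \<in> invariant_measures"
  shows "shift_pow k \<in> measurable \<nu> \<nu>"
  using measurable_shift_pow measurable_cong_sets invariant_measuresD(1)[OF assms] by blast

lemma distr_shift_pow_invariant:
  assumes "\<nu> \<in> invariant_measures"
  shows "distr \<nu> \<nu> (shift_pow k) = \<nu>"
proof -
  note measurable_shift = measurable_shift_pow_invariant[OF assms]
  have shift_0: "distr \<nu> \<nu> (shift_pow 0) = \<nu>"
    using distr_id2[OF refl] by (simp cong: distr_cong)
  have shift_add: "distr (distr \<nu> \<nu> (shift_pow l)) \<nu> (shift_pow k) = distr \<nu> \<nu> (shift_pow (k + l))"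
    for k l
    by (simp add: distr_distr[OF measurable_shift measurable_shift] comp_def shift_pow_shift_pow
        cong: distr_cong)
  have "distr \<nu> \<nu> (shift_pow 1) = distr \<nu> Omega_borel shift"
    using invariant_measuresD(1)[OF assms]
    by (intro distr_cong) (auto simp: fun_eq_iff shift_pow_apply shift_def)
  also have "\<dots> = \<nu>"
    using assms by (simp add: invariant_measures_def)
  finally have shift_1: "distr \<nu> \<nu> (shift_pow 1) = \<nu>" .
  show ?thesis
  proof (induction k rule: int_induct[where k=0])
    case base
    show ?case by (rule shift_0)
  next
    case (step1 i)
    with shift_add[of 1 i] shift_1 show ?case
      by (simp add: add.commute)
  next
    case (step2 i)
    with shift_add[of 1 "-1"] shift_add[of i "-1"] shift_0 shift_1 show ?case
      by simp
  qed
qed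

lemma AE_shift_pow:
  assumes "\<nu> \<in> invariant_measures" "AE \<omega> in \<nu>. P \<omega>"
  shows "AE \<omega> in \<nu>. P (shift_pow k \<omega>)"
proof (rule AE_distrD[OF measurable_shift_pow_invariant[OF assms(1)]])
  show "AE \<omega> in distr \<nu> \<nu> (shift_pow k). P \<omega>"
    unfolding distr_shift_pow_invariant[OF assms(1)] by (rule assms(2))
qed

lemma sets_coordinate_eq:
  assumes "\<nu> \<in> invariant_measures"
  shows "{\<omega> \<in> Omega. \<omega> x = \<delta>} \<in> sets \<nu>"
proof -
  have "{\<omega> \<in> space Omega_borel. \<omega> x = \<delta>} \<in> sets Omega_borel"
    by measurable
  then show ?thesis
    by (simp add: invariant_measuresD(1)[OF assms])
qed

lemma emeasure_sign_le_opposite: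
  assumes \<nu>: "\<nu> \<in> invariant_measures" and recurrent: "AE \<omega> in \<nu>. row_recurrent \<omega> \<omega>'"
  shows "emeasure \<nu> {\<omega> \<in> Omega. \<omega> 0 = \<epsilon>} \<le> emeasure \<nu> {\<omega> \<in> Omega. \<omega> 0 = - \<epsilon>}"
proof (rule emeasure_le_of_equivariant_matching[where T=shift_pow
      and R="\<lambda>\<omega> x z. \<omega> x = \<epsilon> \<and> next_crossing \<omega> \<omega>' x z"])
  show "Measurable.pred \<nu> (\<lambda>\<omega>. \<omega> 0 = \<epsilon> \<and> next_crossing \<omega> \<omega>' 0 z)" for z
    unfolding measurable_invariant_measure[OF \<nu>] using pred_next_crossing by measurable
  show "AE \<omega> in \<nu>. \<omega> \<in> {\<omega> \<in> Omega. \<omega> 0 = \<epsilon>} \<longrightarrow> (\<exists>z. \<omega> 0 = \<epsilon> \<and> next_crossing \<omega> \<omega>' 0 z)"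
    using recurrent by eventually_elim (simp add: next_crossing_exists)
  show "\<omega> \<in> {\<omega> \<in> Omega. \<omega> 0 = - \<epsilon>}"
    if "\<omega> \<in> space \<nu>" "\<omega> x = \<epsilon> \<and> next_crossing \<omega> \<omega>' x 0" for \<omega> x
    using that next_crossing_opposite[of \<omega> \<omega>' x 0] by (simp add: invariant_measuresD(2)[OF \<nu>])
  show "x = y" if "\<omega> x = \<epsilon> \<and> next_crossing \<omega> \<omega>' x z" "\<omega> y = \<epsilon> \<and> next_crossing \<omega> \<omega>' y z" for \<omega> x y z
    using that next_crossing_left_unique by blast
qed (simp_all add: measurable_shift_pow_invariant[OF \<nu>] distr_shift_pow_invariant[OF \<nu>]
    sets_coordinate_eq[OF \<nu>] shift_pow_apply next_crossing_translate)

lemma mean_zero_of_row_recurrent: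
  assumes \<nu>: "\<nu> \<in> invariant_measures" and "AE \<omega> in \<nu>. row_recurrent \<omega> \<omega>'"
  shows "(LINT \<omega>|\<nu>. real_of_int (\<omega> 0)) = 0"
proof -
  interpret prob_space \<nu>
    by (rule invariant_measuresD(3)[OF \<nu>])
  define A where "A \<epsilon> = {\<omega> \<in> Omega. \<omega> 0 = \<epsilon>}" for \<epsilon>
  have "emeasure \<nu> (A 1) = emeasure \<nu> (A (-1))"
    using emeasure_sign_le_opposite[OF assms, of 1] emeasure_sign_le_opposite[OF assms, of "-1"]
    by (simp add: A_def)
  then have balanced: "measure \<nu> (A 1) = measure \<nu> (A (-1))"
    by (simp add: measure_def)
  have A: "A \<epsilon> \<in> sets \<nu>" for \<epsilon>
    unfolding A_def by (rule sets_coordinate_eq[OF \<nu>])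
  have "(LINT \<omega>|\<nu>. real_of_int (\<omega> 0)) = (LINT \<omega>|\<nu>. indicator (A 1) \<omega> - indicator (A (-1)) \<omega>)"
    by (intro Bochner_Integration.integral_cong)
      (auto simp: invariant_measuresD(2)[OF \<nu>] A_def indicator_def dest: OmegaD[of _ 0])
  also have "\<dots> = measure \<nu> (A 1) - measure \<nu> (A (-1))"
    using A by (subst Bochner_Integration.integral_diff)
      (auto simp: Int_absorb2 sets.sets_into_space less_top[symmetric])
  finally show ?thesis
    using balanced by simp
qed

section \<open>Ergodic decomposition\<close>

lemma measurable_ergodic_decomposition:
  assumes "is_ergodic_decomposition \<mu> \<Lambda>"
  shows "(\<lambda>\<nu>. \<nu>) \<in> measurable \<Lambda> (prob_algebra Omega_borel)"
proof -
  have "sets \<Lambda> = sets (restrict_space (prob_algebra Omega_borel) invariant_measures)"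
    using assms by (simp add: is_ergodic_decomposition_def)
  from measurable_cong_sets[OF this refl] show ?thesis
    by (metis measurable_restrict_space1 measurable_ident_sets)
qed

lemma ergodic_decomposition_integral:
  fixes f :: "(int \<Rightarrow> int) \<Rightarrow> real"
  assumes decomposition: "is_ergodic_decomposition \<mu> \<Lambda>"
    and f: "continuous_on Omega f" "\<And>\<omega>. \<omega> \<in> Omega \<Longrightarrow> \<bar>f \<omega>\<bar> \<le> B"
  shows "(LINT \<omega>|\<mu>. f \<omega>) = (LINT \<omega>|(\<Lambda> \<bind> (\<lambda>\<nu>. \<nu>)). f \<omega>)"
proof -
  note components = measurable_prob_algebraD[OF measurable_ergodic_decomposition[OF decomposition]]
  have "prob_space \<Lambda>" and ergodic: "emeasure \<Lambda> ergodic_measures = 1"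
    using decomposition by (simp_all add: is_ergodic_decomposition_def)
  interpret prob_space \<Lambda> by fact
  have measurable_f: "f \<in> borel_measurable Omega_borel"
    unfolding Omega_borel_def by (rule borel_measurable_continuous_on_restrict[OF f(1)])
  have measurable_integral: "(\<lambda>\<nu>. LINT \<omega>|\<nu>. f \<omega>) \<in> borel_measurable \<Lambda>"
    by (rule measurable_compose[OF components integral_measurable_subprob_algebra[OF measurable_f]])
  have "(LINT \<omega>|\<mu>. f \<omega>) = (LINT \<nu>:ergodic_measures|\<Lambda>. (LINT \<omega>|\<nu>. f \<omega>))"
    using decomposition f(1) by (simp add: is_ergodic_decomposition_def)
  also have "\<dots> = (LINT \<nu>|\<Lambda>. (LINT \<omega>|\<nu>. f \<omega>))"
    unfolding set_lebesgue_integral_def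
  proof (rule integral_cong_AE)
    have "AE \<nu> in \<Lambda>. \<nu> \<in> ergodic_measures"
      using ergodic by (intro AE_prob_1) (simp add: measure_def)
    then show "AE \<nu> in \<Lambda>. indicator ergodic_measures \<nu> *\<^sub>R (LINT \<omega>|\<nu>. f \<omega>) = (LINT \<omega>|\<nu>. f \<omega>)"
      by eventually_elim simp
    have "ergodic_measures \<in> sets \<Lambda>"
      using ergodic emeasure_notin_sets by fastforce
    then show "(\<lambda>\<nu>. indicator ergodic_measures \<nu> *\<^sub>R (LINT \<omega>|\<nu>. f \<omega>)) \<in> borel_measurable \<Lambda>"
      using measurable_integral by measurable
  qed (rule measurable_integral)
  also have "\<dots> = (LINT \<omega>|(\<Lambda> \<bind> (\<lambda>\<nu>. \<nu>)). f \<omega>)"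
  proof (rule integral_bind[symmetric, where B=B, OF measurable_f _ components finite_measure_axioms])
    show "AE \<nu> in \<Lambda>. emeasure \<nu> (space \<nu>) \<le> ennreal 1"
      using measurable_space[OF components]
      by (auto simp: space_subprob_algebra intro!: subprob_space.emeasure_space_le_1)
  qed (simp add: f(2))
  finally show ?thesis .
qed

lemma ergodic_decomposition_eq_bind:
  assumes \<mu>: "\<mu> \<in> invariant_measures" and decomposition: "is_ergodic_decomposition \<mu> \<Lambda>"
  shows "\<mu> = \<Lambda> \<bind> (\<lambda>\<nu>. \<nu>)"
proof (rule measure_eqI_clopen)
  note components = measurable_ergodic_decomposition[OF decomposition]
  have \<Lambda>: "\<Lambda> \<in> space (prob_algebra \<Lambda>)"
    using decomposition by (simp add: space_prob_algebra is_ergodic_decomposition_def)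
  show sets: "sets \<mu> = sets (restrict_space borel Omega)"
    "sets (\<Lambda> \<bind> (\<lambda>\<nu>. \<nu>)) = sets (restrict_space borel Omega)"
    using invariant_measuresD(1)[OF \<mu>] sets_bind'[OF \<Lambda> components]
    by (simp_all add: Omega_borel_def)
  show "finite_measure \<mu>" "finite_measure (\<Lambda> \<bind> (\<lambda>\<nu>. \<nu>))"
    using invariant_measuresD(3)[OF \<mu>] prob_space_bind'[OF \<Lambda> components]
    by (simp_all add: prob_space.finite_measure)
  fix U :: "(int \<Rightarrow> int) set"
  assume "open U" "closed U"
  then have "(LINT \<omega>|\<mu>. indicator U \<omega>) = (LINT \<omega>|(\<Lambda> \<bind> (\<lambda>\<nu>. \<nu>)). indicator U \<omega> :: real)"
    by (intro ergodic_decomposition_integral[OF decomposition, where B=1]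
        continuous_on_indicator_clopen) simp_all
  then show "measure \<mu> (U \<inter> Omega) = measure (\<Lambda> \<bind> (\<lambda>\<nu>. \<nu>)) (U \<inter> Omega)"
    using sets[THEN sets_eq_imp_space_eq] by (simp add: space_restrict_space)
qed

lemma AE_ergodic_decomposition:
  assumes "\<mu> \<in> invariant_measures" "is_ergodic_decomposition \<mu> \<Lambda>"
    and "Measurable.pred Omega_borel P" "AE \<omega> in \<mu>. P \<omega>"
  shows "AE \<nu> in \<Lambda>. AE \<omega> in \<nu>. P \<omega>"
  using assms(4)
    AE_bind[OF measurable_prob_algebraD[OF measurable_ergodic_decomposition[OF assms(2)]] assms(3)]
  unfolding ergodic_decomposition_eq_bind[OF assms(1,2), symmetric] by blast

section \<open>Stable orbits almost everywhere\<close>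

lemma AE_row_recurrent:
  assumes \<mu>: "\<mu> \<in> invariant_measures" and \<mu>': "\<mu>' \<in> invariant_measures"
    and stable: "AE \<omega>' in \<mu>'. AE \<omega> in \<mu>. stable_in_all_directions \<omega> \<omega>'"
  obtains \<omega>' where "AE \<omega> in \<mu>. row_recurrent \<omega> \<omega>'"
proof -
  interpret \<mu>': prob_space \<mu>'
    by (rule invariant_measuresD(3)[OF \<mu>'])
  have "AE \<omega>' in \<mu>'. AE \<omega> in \<mu>. stable_in_all_directions (shift_pow x \<omega>) (shift_pow y \<omega>')" for x y
    using AE_shift_pow[OF \<mu>' stable, of y] by eventually_elim (rule AE_shift_pow[OF \<mu>])
  then have "AE \<omega>' in \<mu>'. AE \<omega> in \<mu>. \<forall>x y. stable_in_all_directions (shift_pow x \<omega>) (shift_pow y \<omega>')"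
    by (simp add: AE_all_countable)
  with AE_space have "AE \<omega>' in \<mu>'. \<omega>' \<in> Omega \<and>
      (AE \<omega> in \<mu>. \<forall>x y. stable_in_all_directions (shift_pow x \<omega>) (shift_pow y \<omega>'))"
    by eventually_elim (simp add: invariant_measuresD(2)[OF \<mu>'])
  then obtain \<omega>' where \<omega>': "\<omega>' \<in> Omega"
    and translates: "AE \<omega> in \<mu>. \<forall>x y. stable_in_all_directions (shift_pow x \<omega>) (shift_pow y \<omega>')"
    using eventually_happens'[OF \<mu>'.ae_filter_bot] by blast
  from translates AE_space have "AE \<omega> in \<mu>. row_recurrent \<omega> \<omega>'"
    by eventually_elim
      (simp add: invariant_measuresD(2)[OF \<mu>] stable_translates_imp_row_recurrent[OF _ \<omega>'])
  then show thesis
    by (rule that)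
qed

lemma ergodic_components_mean_zero:
  assumes "\<mu> \<in> invariant_measures" "\<mu>' \<in> invariant_measures" "is_ergodic_decomposition \<mu> \<Lambda>"
    and "AE \<omega>' in \<mu>'. AE \<omega> in \<mu>. stable_in_all_directions \<omega> \<omega>'"
  shows "AE \<nu> in \<Lambda>. \<nu> \<in> ergodic_measures \<longrightarrow> (LINT \<omega>|\<nu>. real_of_int (\<omega> 0)) = 0"
proof -
  obtain \<omega>' where "AE \<omega> in \<mu>. row_recurrent \<omega> \<omega>'"
    using AE_row_recurrent[OF assms(1,2,4)] .
  then have "AE \<nu> in \<Lambda>. AE \<omega> in \<nu>. row_recurrent \<omega> \<omega>'"
    by (rule AE_ergodic_decomposition[OF assms(1,3) pred_row_recurrent])
  then show ?thesis
    by eventually_elim (auto simp: ergodic_measures_def intro: mean_zero_of_row_recurrent)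
qed

lemma AE_mu_N: "(AE v in mu_N. P v) \<longleftrightarrow> (\<forall>v\<in>N_dirs. P v)"
proof -
  have "0 < ennreal (1 / real (card N_dirs))"
    by (simp add: N_dirs_def)
  then show ?thesis
    unfolding mu_N_def uniform_count_measure_def AE_point_measure by simp
qed

lemma prob_space_mu_N: "prob_space mu_N"
  unfolding mu_N_def by (rule prob_space_uniform_count_measure) (auto simp: N_dirs_def)

lemma space_mu_N: "space mu_N = N_dirs"
  by (simp add: mu_N_def space_uniform_count_measure)

lemma sets_stable_in_all_directions:
  assumes "\<mu> \<in> invariant_measures" "\<mu>' \<in> invariant_measures"
  shows "{p \<in> space (\<mu> \<Otimes>\<^sub>M \<mu>'). stable_in_all_directions (fst p) (snd p)} \<in> sets (\<mu> \<Otimes>\<^sub>M \<mu>')"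
proof -
  let ?unstable = "{p \<in> X_space. \<not> has_stable_periodic_orbit p}"
  let ?slice = "\<lambda>v. (\<lambda>p. (fst p, snd p, v)) -` ?unstable \<inter> space (\<mu> \<Otimes>\<^sub>M \<mu>')"
  note invariant = invariant_measuresD[OF assms(1)] invariant_measuresD[OF assms(2)]
  have "?slice v \<in> sets (\<mu> \<Otimes>\<^sub>M \<mu>')" if "v \<in> N_dirs" for v
    using that no_stable_periodic_orbit_measurable[OF invariant(1,4)]
    by (intro measurable_sets[where A="\<mu> \<Otimes>\<^sub>M \<mu>' \<Otimes>\<^sub>M mu_N"] measurable_Pair) (auto simp: space_mu_N)
  then have "space (\<mu> \<Otimes>\<^sub>M \<mu>') - (\<Union>v\<in>N_dirs. ?slice v) \<in> sets (\<mu> \<Otimes>\<^sub>M \<mu>')"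
    by (intro sets.compl_sets sets.finite_UN) (auto simp: N_dirs_def)
  also have "space (\<mu> \<Otimes>\<^sub>M \<mu>') - (\<Union>v\<in>N_dirs. ?slice v)
      = {p \<in> space (\<mu> \<Otimes>\<^sub>M \<mu>'). stable_in_all_directions (fst p) (snd p)}"
    by (auto simp: space_pair_measure X_space_def stable_in_all_directions_def invariant)
  finally show ?thesis .
qed

lemma AE_stable_in_all_directions:
  assumes \<mu>: "\<mu> \<in> invariant_measures" and \<mu>': "\<mu>' \<in> invariant_measures"
    and null: "emeasure (\<mu> \<Otimes>\<^sub>M \<mu>' \<Otimes>\<^sub>M mu_N) {p \<in> X_space. \<not> has_stable_periodic_orbit p} = 0"
  shows "AE \<omega> in \<mu>. AE \<omega>' in \<mu>'. stable_in_all_directions \<omega> \<omega>'"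
    and "AE \<omega>' in \<mu>'. AE \<omega> in \<mu>. stable_in_all_directions \<omega> \<omega>'"
proof -
  note invariant = invariant_measuresD[OF \<mu>] invariant_measuresD[OF \<mu>']
  interpret \<mu>: prob_space \<mu> by (rule invariant(3))
  interpret \<mu>': prob_space \<mu>' by (rule invariant(6))
  interpret N: prob_space mu_N by (rule prob_space_mu_N)
  interpret \<mu>'_N: pair_prob_space \<mu>' mu_N ..
  interpret \<mu>_\<mu>'_N: pair_prob_space \<mu> "\<mu>' \<Otimes>\<^sub>M mu_N" ..
  interpret \<mu>_\<mu>': pair_prob_space \<mu> \<mu>' ..
  have "AE p in \<mu> \<Otimes>\<^sub>M \<mu>' \<Otimes>\<^sub>M mu_N. has_stable_periodic_orbit p"
    using null no_stable_periodic_orbit_measurable[OF invariant(1,4)]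
    by (intro AE_I[where N="{p \<in> X_space. \<not> has_stable_periodic_orbit p}"])
      (auto simp: space_pair_measure X_space_def invariant space_mu_N)
  then have "AE \<omega> in \<mu>. AE q in \<mu>' \<Otimes>\<^sub>M mu_N. has_stable_periodic_orbit (\<omega>, q)"
    by (rule \<mu>_\<mu>'_N.AE_pair)
  then show "AE \<omega> in \<mu>. AE \<omega>' in \<mu>'. stable_in_all_directions \<omega> \<omega>'"
    by eventually_elim (drule \<mu>'_N.AE_pair, simp add: AE_mu_N stable_in_all_directions_def)
  then show "AE \<omega>' in \<mu>'. AE \<omega> in \<mu>. stable_in_all_directions \<omega> \<omega>'"
    using \<mu>_\<mu>'.AE_commute[OF sets_stable_in_all_directions[OF \<mu> \<mu>']] by blast
qed

theorem corollary10:
  fixes \<mu> \<mu>' :: "(int \<Rightarrow> int) measure"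
    and \<Lambda> \<Lambda>' :: "(int \<Rightarrow> int) measure measure"
  assumes "\<mu> \<in> invariant_measures"
    and "\<mu>' \<in> invariant_measures"
    and "is_ergodic_decomposition \<mu> \<Lambda>"
    and "is_ergodic_decomposition \<mu>' \<Lambda>'"
    and "emeasure (\<mu> \<Otimes>\<^sub>M \<mu>' \<Otimes>\<^sub>M mu_N) {p \<in> X_space. \<not> has_stable_periodic_orbit p} = 0"
  shows "(AE \<nu> in \<Lambda>. \<nu> \<in> ergodic_measures \<longrightarrow> (LINT \<omega>|\<nu>. real_of_int (\<omega> 0)) = 0) \<and>
    (AE \<nu> in \<Lambda>'. \<nu> \<in> ergodic_measures \<longrightarrow> (LINT \<omega>|\<nu>. real_of_int (\<omega> 0)) = 0)"
proof
  note stable = AE_stable_in_all_directions[OF assms(1,2,5)]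
  show "AE \<nu> in \<Lambda>. \<nu> \<in> ergodic_measures \<longrightarrow> (LINT \<omega>|\<nu>. real_of_int (\<omega> 0)) = 0"
    by (rule ergodic_components_mean_zero[OF assms(1,2,3) stable(2)])
  have "AE \<omega> in \<mu>. AE \<omega>' in \<mu>'. stable_in_all_directions \<omega>' \<omega>"
    using stable(1) by (subst stable_in_all_directions_commute)
  then show "AE \<nu> in \<Lambda>'. \<nu> \<in> ergodic_measures \<longrightarrow> (LINT \<omega>|\<nu>. real_of_int (\<omega> 0)) = 0"
    by (rule ergodic_components_mean_zero[OF assms(2,1,4)])
qed

end
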